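(* Let $\lambda$ be the Lebesgue measure on $\mathbb{R}^d$ and let $\mu=\lambda|_{[0,1]^d}$. Then $\nu=\lambda$ is a $(p,q)$-Bessel measure for $\mu$ for every $1\le p\le2$, where $q$ is the conjugate exponent to $p$.
   Context: For $t\in\mathbb{R}^d$ let $e_t(x)=e^{2\pi i t\cdot x}$. For a Borel probability measure $\mu$ on $\mathbb{R}^d$, $1\le p<\infty$, $f\in L^p(\mu)$ and $t\in\mathbb{R}^d$, put $\widehat{f d\mu}(t)=\int f(x)e^{-2\pi i t\cdot x}\,d\mu(x)$. The compatible semi-inner product $[f,g]_{L^p(\mu)}=\|g\|_{L^p(\mu)}^{2-p}\int f|g|^{p-1}\overline{\mathrm{sgn}(g)}\,d\mu$ satisfies $[f,e_t]_{L^p(\mu)}=\widehat{f d\mu}(t)$ for a probability measure $\mu$. For conjugate exponents $1<p,q<\infty$, a Borel measure $\nu$ on $\mathbb{R}^d$ is a $(p,q)$-Bessel measure for $\mu$ if there is $B>0$ with $\int_{\mathbb{R}^d}|[f,e_t]_{L^p(\mu)}|^q\,d\nu(t)\le B\|f\|_{L^p(\mu)}^q$ for all $f\in L^p(\mu)$. For $p=1$, $q=\infty$, the condition is $\|\widehat{f d\mu}\|_\infty\le B\|f\|_{L^1(\mu)}$ for all $f\in L^1(\mu)$, where $\|\cdot\|_\infty$ is the norm of $L^\infty(\nu)$. *)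

theory Defs
  imports "HOL-Probability.Probability"
begin

definition conjugate_exponents :: "real \<Rightarrow> ennreal \<Rightarrow> bool" where
  "conjugate_exponents p q \<longleftrightarrow> 1 \<le> p \<and> inverse (ennreal p) + inverse q = 1"

definition expo :: "real ^ 'd \<Rightarrow> real ^ 'd \<Rightarrow> complex" where
  "expo t x = exp (2 * complex_of_real pi * \<i> * complex_of_real (t \<bullet> x))"

text \<open>Elements of $L^p$ are represented by functions, not by classes modulo a.e. equality.\<close>

definition Lp_space :: "'a measure \<Rightarrow> real \<Rightarrow> ('a \<Rightarrow> complex) set" where
  "Lp_space M p = {f \<in> borel_measurable M. integrable M (\<lambda>x. norm (f x) powr p)}"

definition Lp_norm :: "'a measure \<Rightarrow> real \<Rightarrow> ('a \<Rightarrow> complex) \<Rightarrow> real" where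
  "Lp_norm M p f = (\<integral>x. norm (f x) powr p \<partial>M) powr (1 / p)"

definition Linf_norm :: "'a measure \<Rightarrow> ('a \<Rightarrow> complex) \<Rightarrow> ennreal" where
  "Linf_norm M f = esssup M (\<lambda>x. ennreal (norm (f x)))"

definition fourier :: "(real ^ 'd) measure \<Rightarrow> (real ^ 'd \<Rightarrow> complex) \<Rightarrow> real ^ 'd \<Rightarrow> complex" where
  "fourier M f t = (\<integral>x. f x * exp (- 2 * complex_of_real pi * \<i> * complex_of_real (t \<bullet> x)) \<partial>M)"

definition semi_inner ::
    "'a measure \<Rightarrow> real \<Rightarrow> ('a \<Rightarrow> complex) \<Rightarrow> ('a \<Rightarrow> complex) \<Rightarrow> complex" where
  "semi_inner M p f g =
     complex_of_real (Lp_norm M p g powr (2 - p)) *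
       (\<integral>x. f x * complex_of_real (norm (g x) powr (p - 1)) * cnj (sgn (g x)) \<partial>M)"

lemma semi_inner_expo:
  assumes "prob_space M"
  shows "semi_inner M p f (expo t) = fourier M f t"
proof -
  interpret prob_space M by fact
  have n: "norm (expo t x) = 1" for x
    using norm_exp_i_times[of "2 * pi * (t \<bullet> x)"] by (simp add: expo_def mult_ac)
  have c: "cnj (sgn (expo t x)) = exp (- 2 * complex_of_real pi * \<i> * complex_of_real (t \<bullet> x))" for x
    using n[of x] by (simp add: sgn_eq) (simp add: expo_def exp_cnj)
  show ?thesis
    by (simp add: semi_inner_def fourier_def Lp_norm_def n c prob_space)
qed

text \<open>
  The quantity bounded in the case of finite \<open>q\<close> is a Lebesgue integral in \<open>[0, \<infinity>]\<close>, so the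
  inequality includes its finiteness.
\<close>

definition bessel_measure ::
    "real \<Rightarrow> ennreal \<Rightarrow> (real ^ 'd) measure \<Rightarrow> (real ^ 'd) measure \<Rightarrow> bool" where
  "bessel_measure p q \<mu> \<nu> \<longleftrightarrow>
     sets \<nu> = sets borel \<and>
     (\<exists>B>0. \<forall>f\<in>Lp_space \<mu> p.
        if q = \<infinity> then Linf_norm \<nu> (fourier \<mu> f) \<le> ennreal (B * Lp_norm \<mu> p f)
        else (\<integral>\<^sup>+t. ennreal (norm (semi_inner \<mu> p f (expo t)) powr enn2real q) \<partial>\<nu>)
               \<le> ennreal (B * Lp_norm \<mu> p f powr enn2real q))"

text \<open>Lebesgue measure restricted to the unit cube, regarded as a measure on the whole space.\<close>

definition cube_measure :: "(real ^ 'd) measure" where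
  "cube_measure = density lborel (indicator {x. \<forall>i. 0 \<le> x $ i \<and> x $ i \<le> 1})"

lemma cube_eq_cbox: "{x :: real ^ 'd. \<forall>i. 0 \<le> x $ i \<and> x $ i \<le> 1} = cbox 0 1"
  by (auto simp: mem_box_cart)

lemma sets_cube_measure: "sets cube_measure = sets borel"
  by (simp add: cube_measure_def)

lemma emeasure_cube_measure:
  "A \<in> sets borel \<Longrightarrow> emeasure cube_measure A = emeasure lborel (A \<inter> cbox 0 1)"
  unfolding cube_measure_def cube_eq_cbox
  by (subst emeasure_density)
     (auto simp: indicator_inter_arith[symmetric] mult.commute Int_commute)

lemma prob_space_cube_measure: "prob_space (cube_measure :: (real ^ 'd) measure)"
proof
  have "(1 :: real ^ 'd) \<bullet> b = 1" if "b \<in> Basis" for b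
    using that by (auto simp: Basis_vec_def inner_axis)
  then show "emeasure cube_measure (space cube_measure :: (real ^ 'd) set) = 1"
    by (subst emeasure_cube_measure)
       (auto simp: cube_measure_def emeasure_lborel_cbox_eq)
qed

end

theory Submission
  imports Defs
begin

text \<open>
  The statement is the Hausdorff--Young inequality for functions on the unit cube, up to the value
  of the constant. Since any finite constant will do, real interpolation between the two endpoints
  \<open>p = 1\<close> and \<open>p = 2\<close> suffices and complex interpolation is avoided.

  For \<open>p = 1\<close> the transform is bounded pointwise by \<open>\<integral>|f|\<close>.

  For \<open>p = 2\<close> (\<open>fourier_cube_L2_bound\<close>) the point is that, for each fixed \<open>t\<close>, the exponentials of
  frequency \<open>t + n\<close> with \<open>n\<close> an integer vector are orthonormal on the cube. Bessel's inequality gives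
  \<open>\<Sum>\<^sub>n |F f (t + n)|\<^sup>2 \<le> \<integral>|f|\<^sup>2\<close>, and integrating this over \<open>t\<close> in the unit cube gives the integral
  of \<open>|F f|\<^sup>2\<close> over the whole space, because the integer translates of the cube cover it.

  For \<open>1 < p < 2\<close> (\<open>bessel_measure_interpolate\<close>, valid for every Borel probability measure
  \<open>\<mu>\<close> and \<open>\<sigma>\<close>-finite \<open>\<nu>\<close> that satisfy the \<open>L\<^sup>2\<close> estimate) put \<open>M = \<integral>|f|^p\<close> and, for each level \<open>l > 0\<close>, split \<open>f\<close> according to whether
  \<open>l |f|^(p - 1) \<le> 2 M\<close>. The \<open>L\<^sup>1\<close> norm of the large part is at most \<open>l / 2\<close>, so wherever
  \<open>|F f| \<ge> l\<close> the transform of the small part is at least \<open>l / 2\<close>. Hence \<open>|F f|^q\<close> is dominated by a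
  weighted integral over \<open>l\<close> of the squared transforms of the small parts, to which the \<open>L\<^sup>2\<close> estimate
  applies after an exchange of integrals. The remaining integral over \<open>l\<close> is elementary, and the
  exponents match exactly because \<open>p\<close> and \<open>q\<close> are conjugate.
\<close>

section \<open>Exponentials and the Fourier transform\<close>

lemma norm_expo [simp]: "norm (expo t x) = 1"
  using norm_exp_i_times[of "2 * pi * (t \<bullet> x)"] by (simp add: expo_def mult_ac)

lemma expo_diff: "expo (s - t) x = expo s x * cnj (expo t x)"
  by (simp add: expo_def inner_diff_left exp_cnj exp_add[symmetric] algebra_simps)

lemma fourier_alt: "fourier M f t = (\<integral>x. f x * cnj (expo t x) \<partial>M)"
  by (simp add: fourier_def expo_def exp_cnj)

lemma expo_measurable [measurable (raw)]:
  assumes "f \<in> borel_measurable M" "g \<in> borel_measurable M"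
  shows "(\<lambda>x. expo (f x) (g x)) \<in> borel_measurable M"
  using assms unfolding expo_def by measurable

lemma fourier_measurable:
  fixes f :: "real ^ 'd \<Rightarrow> complex"
  assumes "sigma_finite_measure M" and sets_M [measurable_cong]: "sets M = sets borel"
    and [measurable]: "f \<in> borel_measurable borel"
  shows "fourier M f \<in> borel_measurable borel"
proof -
  interpret sigma_finite_measure M by fact
  show ?thesis
    unfolding fourier_def by measurable
qed

lemma norm_fourier_le: "norm (fourier M f t) \<le> (\<integral>x. norm (f x) \<partial>M)"
  unfolding fourier_alt by (rule order_trans[OF integral_norm_bound]) (simp add: norm_mult)

lemma bessel_measure_1_infinity:
  fixes \<mu> \<nu> :: "(real ^ 'd) measure"
  assumes "sigma_finite_measure \<mu>" "sets \<mu> = sets borel" "sets \<nu> = sets borel"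
  shows "bessel_measure 1 \<infinity> \<mu> \<nu>"
proof -
  have "Linf_norm \<nu> (fourier \<mu> f) \<le> ennreal (1 * Lp_norm \<mu> 1 f)" if f: "f \<in> Lp_space \<mu> 1" for f
  proof -
    have "f \<in> borel_measurable borel"
      using f measurable_cong_sets[OF assms(2) refl] by (auto simp: Lp_space_def)
    then have [measurable]: "fourier \<mu> f \<in> borel_measurable \<nu>"
      using fourier_measurable[OF assms(1,2)] measurable_cong_sets[OF assms(3) refl] by blast
    show ?thesis
      unfolding Linf_norm_def Lp_norm_def
      by (rule esssup_I) (auto simp: norm_fourier_le ennreal_leI)
  qed
  then show ?thesis
    using assms(3) unfolding bessel_measure_def by (auto intro!: exI[of _ 1])
qed

section \<open>Orthogonality of the integer frequencies on the cube\<close>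

lemma integral_exp_period:
  fixes m :: real
  assumes "m \<in> \<int>"
  shows "(\<integral>x. indicator {0..1} x *\<^sub>R exp (2 * complex_of_real pi * \<i> * complex_of_real (m * x)) \<partial>lborel)
    = (if m = 0 then 1 else 0)"
proof (cases "m = 0")
  case True
  have "(\<integral>x. indicator {0..1::real} x *\<^sub>R (1::complex) \<partial>lborel) = 1"
    by (simp add: lebesgue_integral_const measure_def)
  with True show ?thesis by simp
next
  case False
  define c where "c = 2 * complex_of_real pi * \<i> * complex_of_real m"
  have c: "c \<noteq> 0" using False by (simp add: c_def)
  have "(\<integral>x. indicator {0..1} x *\<^sub>R exp (c * complex_of_real x) \<partial>lborel)
      = exp (c * complex_of_real 1) / c - exp (c * complex_of_real 0) / c"
  proof (rule integral_FTC_atLeastAtMost)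
    fix x :: real
    have "((\<lambda>z. exp (c * z) / c) has_field_derivative exp (c * complex_of_real x)) (at (complex_of_real x))"
      using c by (auto intro!: derivative_eq_intros)
    then have "((\<lambda>x. exp (c * complex_of_real x) / c) has_vector_derivative exp (c * complex_of_real x)) (at x)"
      using has_vector_derivative_real_field by blast
    then show "((\<lambda>x. exp (c * complex_of_real x) / c) has_vector_derivative exp (c * complex_of_real x))
        (at x within {0..1})"
      by (rule has_vector_derivative_at_within)
  qed (auto intro!: continuous_intros)
  moreover have "exp c = 1"
    using assms by (auto simp: c_def exp_eq_1 Ints_def)
  ultimately show ?thesis
    using False by (simp add: c_def mult_ac)
qed

lemma integral_cube_eq:
  fixes f :: "real ^ 'd \<Rightarrow> complex"
  assumes [measurable]: "f \<in> borel_measurable borel"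
  shows "(\<integral>x. f x \<partial>cube_measure) = (\<integral>x. indicator (cbox 0 1) x *\<^sub>R f x \<partial>lborel)"
proof -
  have "cube_measure = density lborel (\<lambda>x. ennreal (indicat_real (cbox 0 1 :: (real ^ 'd) set) x))"
    unfolding cube_measure_def cube_eq_cbox by (simp add: ennreal_indicator)
  moreover have "(\<integral>x. f x \<partial>density lborel (\<lambda>x. ennreal (indicat_real (cbox 0 1 :: (real ^ 'd) set) x)))
      = (\<integral>x. indicator (cbox 0 1) x *\<^sub>R f x \<partial>lborel)"
    by (rule integral_density) auto
  ultimately show ?thesis
    by simp
qed

text \<open>
  The integrand is a product of functions of one coordinate each, so the integral over the cube
  factors, and a coordinate in which \<open>k\<close> is a nonzero integer contributes a full number of periods.
\<close>

lemma integral_expo_cube: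
  fixes k :: "real ^ 'd"
  assumes "\<And>i. k $ i \<in> \<int>"
  shows "(\<integral>x. expo k x \<partial>cube_measure) = (if k = 0 then 1 else 0)"
proof -
  interpret product_sigma_finite "\<lambda>_ :: real ^ 'd. lborel :: real measure" ..
  define g where "g b y = indicator {0..1} y *\<^sub>R exp (2 * complex_of_real pi * \<i> * complex_of_real ((k \<bullet> b) * y))"
    for b :: "real ^ 'd" and y :: real
  have one: "(1 :: real ^ 'd) \<bullet> b = 1" if "b \<in> Basis" for b
    using that by (auto simp: Basis_vec_def inner_axis)
  have kb: "k \<bullet> b \<in> \<int>" if "b \<in> Basis" for b
    using that assms by (auto simp: Basis_vec_def inner_axis)
  have g_int: "integrable lborel (g b)" for b
    unfolding g_def set_integrable_def[symmetric]
    by (intro borel_integrable_atLeastAtMost' continuous_intros)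
  have split: "indicator (cbox 0 1) x *\<^sub>R expo k x = (\<Prod>b\<in>Basis. g b (x \<bullet> b))" for x :: "real ^ 'd"
  proof -
    have "indicator (cbox 0 1) x = (\<Prod>b\<in>Basis. indicator {0..1} (x \<bullet> b) :: real)"
      by (auto simp: indicator_def mem_box one prod_zero_iff split: if_splits)
    moreover have "expo k x = (\<Prod>b\<in>Basis. exp (2 * complex_of_real pi * \<i> * complex_of_real ((k \<bullet> b) * (x \<bullet> b))))"
      unfolding expo_def by (subst euclidean_inner) (simp add: exp_sum sum_distrib_left)
    ultimately show ?thesis
      by (simp add: g_def scaleR_conv_of_real prod.distrib)
  qed
  have "(\<integral>x. expo k x \<partial>cube_measure) = (\<integral>x. (\<Prod>b\<in>Basis. g b (x \<bullet> b)) \<partial>(lborel :: (real ^ 'd) measure))"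
    by (simp add: integral_cube_eq split)
  also have "\<dots> = (\<integral>y. (\<Prod>b\<in>Basis. g b (y b)) \<partial>(\<Pi>\<^sub>M b\<in>(Basis :: (real ^ 'd) set). lborel))"
  proof -
    have [measurable]: "g b \<in> borel_measurable borel" for b
      unfolding g_def by measurable
    have sum_meas: "(\<lambda>f. \<Sum>b\<in>Basis. f b *\<^sub>R b) \<in> measurable (\<Pi>\<^sub>M b\<in>(Basis :: (real ^ 'd) set). lborel) borel"
      by measurable
    show ?thesis
      by (subst lborel_eq[where 'a = "real ^ 'd"], subst integral_distr[OF sum_meas]) (simp_all cong: prod.cong)
  qed
  also have "\<dots> = (\<Prod>b\<in>Basis. integral\<^sup>L lborel (g b))"
    by (rule product_integral_prod) (auto simp: g_int)
  also have "\<dots> = (\<Prod>b\<in>Basis. if k \<bullet> b = 0 then 1 else 0)"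
    unfolding g_def by (intro prod.cong refl integral_exp_period kb)
  also have "\<dots> = (if k = 0 then 1 else 0)"
    using euclidean_all_zero_iff[of k] by auto
  finally show ?thesis .
qed

section \<open>The square-integrable endpoint\<close>

text \<open>
  Expand \<open>0 \<le> \<integral>|f - g|\<^sup>2\<close> for \<open>g = \<Sum>\<^sub>i c\<^sub>i e\<^sub>i\<close>, where the \<open>c\<^sub>i\<close> are the coefficients of \<open>f\<close>:
  both \<open>\<integral>f cnj g\<close> and \<open>\<integral>|g|\<^sup>2\<close> equal \<open>A = \<Sum>\<^sub>i |c\<^sub>i|\<^sup>2\<close>, which leaves \<open>\<integral>|f|\<^sup>2 - 2A + A\<close>.
  The bound on the \<open>e\<^sub>i\<close> makes all these products integrable.
\<close>

lemma bessel_inequality: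
  fixes f :: "'a \<Rightarrow> complex" and e :: "'i \<Rightarrow> 'a \<Rightarrow> complex"
  assumes "finite_measure M" "finite S"
    and [measurable]: "f \<in> borel_measurable M" "\<And>i. i \<in> S \<Longrightarrow> e i \<in> borel_measurable M"
    and f2: "integrable M (\<lambda>x. (norm (f x))\<^sup>2)"
    and e_bound: "\<And>i x. i \<in> S \<Longrightarrow> norm (e i x) \<le> K"
    and orth: "\<And>i j. i \<in> S \<Longrightarrow> j \<in> S \<Longrightarrow> (\<integral>x. e i x * cnj (e j x) \<partial>M) = (if i = j then 1 else 0)"
  shows "(\<Sum>i\<in>S. (norm (\<integral>x. f x * cnj (e i x) \<partial>M))\<^sup>2) \<le> (\<integral>x. (norm (f x))\<^sup>2 \<partial>M)"
proof -
  interpret finite_measure M by fact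
  have e_cnj [measurable]: "(\<lambda>x. cnj (e i x)) \<in> borel_measurable M" if "i \<in> S" for i
    by (rule measurable_compose[OF assms(4)[OF that]])
       (intro borel_measurable_continuous_onI continuous_intros)
  define c where "c i = (\<integral>x. f x * cnj (e i x) \<partial>M)" for i
  define g where "g x = (\<Sum>i\<in>S. c i * e i x)" for x
  define A where "A = (\<Sum>i\<in>S. (norm (c i))\<^sup>2)"
  have f1: "integrable M f"
  proof (rule Bochner_Integration.integrable_bound)
    show "integrable M (\<lambda>x. 1 + (norm (f x))\<^sup>2)" using f2 by simp
    show "AE x in M. norm (f x) \<le> norm (1 + (norm (f x))\<^sup>2)"
    proof (rule AE_I2)
      fix x
      show "norm (f x) \<le> norm (1 + (norm (f x))\<^sup>2)"
        using sum_power2_ge_zero[of "norm (f x) - 1" "norm (f x)"]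
        by (simp add: power2_eq_square algebra_simps)
    qed
  qed measurable
  have fe: "integrable M (\<lambda>x. f x * cnj (e i x))" if i: "i \<in> S" for i
  proof (rule Bochner_Integration.integrable_bound)
    show "integrable M (\<lambda>x. K * norm (f x))" using f1 by simp
    show "AE x in M. norm (f x * cnj (e i x)) \<le> norm (K * norm (f x))"
    proof (rule AE_I2)
      fix x
      have "norm (f x * cnj (e i x)) \<le> norm (f x) * K"
        using e_bound[OF i, of x] by (simp add: norm_mult mult_left_mono)
      then show "norm (f x * cnj (e i x)) \<le> norm (K * norm (f x))"
        by (simp add: mult.commute)
    qed
  qed (use i in \<open>auto intro!: borel_measurable_times e_cnj\<close>)
  have ee: "integrable M (\<lambda>x. e i x * cnj (e j x))" if ij: "i \<in> S" "j \<in> S" for i j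
  proof (rule integrable_const_bound[where B = "K * K"])
    have "0 \<le> K" using e_bound[OF ij(1)] norm_ge_zero order_trans by blast
    then show "AE x in M. norm (e i x * cnj (e j x)) \<le> K * K"
      using e_bound ij by (auto simp: norm_mult intro!: mult_mono)
  qed (use ij in \<open>auto intro!: borel_measurable_times e_cnj\<close>)
  have fg_eq: "f x * cnj (g x) = (\<Sum>i\<in>S. cnj (c i) * (f x * cnj (e i x)))" for x
    by (simp add: g_def sum_distrib_left mult_ac)
  have gg_eq: "g x * cnj (g x) = (\<Sum>i\<in>S. \<Sum>j\<in>S. c i * cnj (c j) * (e i x * cnj (e j x)))" for x
    by (simp add: g_def sum_product mult_ac)
  have A: "complex_of_real A = (\<Sum>i\<in>S. cnj (c i) * c i)"
    unfolding A_def of_real_sum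
    by (intro sum.cong refl) (simp add: complex_norm_square[symmetric] mult.commute)
  have fg: "integrable M (\<lambda>x. f x * cnj (g x))" "(\<integral>x. f x * cnj (g x) \<partial>M) = A"
    unfolding fg_eq A c_def[symmetric] by (auto simp: fe c_def)
  have gg: "integrable M (\<lambda>x. g x * cnj (g x))" "(\<integral>x. g x * cnj (g x) \<partial>M) = A"
    unfolding gg_eq A
    by (auto simp: ee orth if_distrib sum.delta \<open>finite S\<close> mult.commute cong: if_cong)
  define u where "u x = f x * cnj (g x)" for x
  define v where "v x = g x * cnj (g x)" for x
  have u: "integrable M (\<lambda>x. Re (u x))" "(\<integral>x. Re (u x) \<partial>M) = A"
    using fg by (simp_all add: u_def[symmetric])
  have v: "integrable M (\<lambda>x. Re (v x))" "(\<integral>x. Re (v x) \<partial>M) = A"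
    using gg by (simp_all add: v_def[symmetric])
  have sq: "(norm (f x - g x))\<^sup>2 = (norm (f x))\<^sup>2 - 2 * Re (u x) + Re (v x)" for x
    unfolding cmod_power2 u_def v_def by (simp add: power2_eq_square algebra_simps)
  have "0 \<le> (\<integral>x. (norm (f x - g x))\<^sup>2 \<partial>M)" by simp
  also have "\<dots> = (\<integral>x. (norm (f x))\<^sup>2 \<partial>M) - A"
    unfolding sq using f2 u v by simp
  finally show ?thesis by (simp add: A_def c_def)
qed

lemma nn_integral_count_space_le:
  fixes f :: "'i :: countable \<Rightarrow> ennreal"
  assumes "\<And>S. finite S \<Longrightarrow> sum f S \<le> c"
  shows "(\<integral>\<^sup>+i. f i \<partial>count_space UNIV) \<le> c"
proof -
  define h where "h = (\<lambda>k. f (from_nat k) * indicator (range (to_nat :: 'i \<Rightarrow> nat)) k)"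
  have bij: "bij_betw (to_nat :: 'i \<Rightarrow> nat) UNIV (range (to_nat :: 'i \<Rightarrow> nat))"
    by (simp add: bij_betw_def)
  have "(\<integral>\<^sup>+i. f i \<partial>count_space UNIV) = (\<integral>\<^sup>+k. f (from_nat k) \<partial>count_space (range (to_nat :: 'i \<Rightarrow> nat)))"
    by (subst nn_integral_bij_count_space[OF bij, symmetric]) simp
  also have "\<dots> = (\<Sum>k. h k)"
    by (subst nn_integral_count_space_indicator) (simp_all add: h_def nn_integral_count_space_nat)
  also have "\<dots> \<le> c"
    unfolding suminf_eq_SUP
  proof (rule SUP_least)
    fix n
    have fin: "finite {i :: 'i. to_nat i < n}"
      using finite_vimageI[OF finite_lessThan inj_to_nat, of n] by (simp add: vimage_def)
    have "sum h {..<n} = sum h (to_nat ` {i :: 'i. to_nat i < n})"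
      by (rule sum.mono_neutral_right) (auto simp: h_def indicator_def)
    also have "\<dots> = sum f {i. to_nat i < n}"
      by (subst sum.reindex) (auto simp: h_def intro: inj_on_subset[OF inj_to_nat])
    also have "\<dots> \<le> c" by (rule assms[OF fin])
    finally show "sum h {..<n} \<le> c" .
  qed
  finally show ?thesis .
qed

definition lattice_point :: "int ^ 'd \<Rightarrow> real ^ 'd" where
  "lattice_point n = (\<chi> i. real_of_int (n $ i))"

text \<open>
  The integer translates of the unit cube cover the space, so the integral of \<open>F\<close> is at most the sum
  of its integrals over these translates. Moving every translate back to the unit cube turns this
  into the integral over the cube of the periodization of \<open>F\<close>, and the cube has volume one.
  The closed cubes overlap, but only an inequality is wanted, so covering is enough.
\<close>

lemma nn_integral_periodize:
  fixes F :: "real ^ 'd \<Rightarrow> ennreal"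
  assumes [measurable]: "F \<in> borel_measurable borel"
    and periodic_sum: "\<And>t. (\<integral>\<^sup>+n. F (lattice_point n + t) \<partial>count_space UNIV) \<le> C"
  shows "(\<integral>\<^sup>+t. F t \<partial>lborel) \<le> C"
proof -
  let ?Q = "cbox 0 1 :: (real ^ 'd) set"
  have cover: "1 \<le> (\<integral>\<^sup>+n. indicator ?Q (t - lattice_point n) \<partial>count_space UNIV)" for t
  proof -
    define m :: "int ^ 'd" where "m = (\<chi> i. \<lfloor>t $ i\<rfloor>)"
    have "t - lattice_point m \<in> ?Q"
      unfolding cube_eq_cbox[symmetric] by (auto simp: lattice_point_def m_def) linarith
    then have "(\<integral>\<^sup>+n. indicator {m} n \<partial>count_space UNIV) \<le> (\<integral>\<^sup>+n. indicator ?Q (t - lattice_point n) \<partial>count_space UNIV)"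
      by (intro nn_integral_mono) (auto simp: indicator_def)
    then show ?thesis by simp
  qed
  have vol: "emeasure lborel ?Q = 1"
    using prob_space.emeasure_space_1[OF prob_space_cube_measure[where 'd = 'd]]
      emeasure_cube_measure[of "UNIV :: (real ^ 'd) set"]
    by (simp add: cube_measure_def)
  have "(\<integral>\<^sup>+t. F t \<partial>lborel) \<le> (\<integral>\<^sup>+t. F t * (\<integral>\<^sup>+n. indicator ?Q (t - lattice_point n) \<partial>count_space UNIV) \<partial>lborel)"
    using mult_left_mono[OF cover] by (intro nn_integral_mono) simp
  also have "\<dots> = (\<integral>\<^sup>+t. (\<integral>\<^sup>+n. F t * indicator ?Q (t - lattice_point n) \<partial>count_space UNIV) \<partial>lborel)"
    by (simp add: nn_integral_cmult)
  also have "\<dots> = (\<integral>\<^sup>+n. (\<integral>\<^sup>+t. F t * indicator ?Q (t - lattice_point n) \<partial>lborel) \<partial>count_space UNIV)"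
    by (rule nn_integral_count_space_nn_integral) auto
  also have "\<dots> = (\<integral>\<^sup>+n. (\<integral>\<^sup>+t. F (lattice_point n + t) * indicator ?Q t \<partial>lborel) \<partial>count_space UNIV)"
  proof (rule nn_integral_cong)
    fix n :: "int ^ 'd"
    show "(\<integral>\<^sup>+t. F t * indicator ?Q (t - lattice_point n) \<partial>lborel)
        = (\<integral>\<^sup>+t. F (lattice_point n + t) * indicator ?Q t \<partial>lborel)"
      by (subst lborel_distr_plus[of "lattice_point n", symmetric], subst nn_integral_distr) simp_all
  qed
  also have "\<dots> = (\<integral>\<^sup>+t. (\<integral>\<^sup>+n. F (lattice_point n + t) * indicator ?Q t \<partial>count_space UNIV) \<partial>lborel)"
    by (rule nn_integral_count_space_nn_integral[symmetric]) auto
  also have "\<dots> = (\<integral>\<^sup>+t. (\<integral>\<^sup>+n. F (lattice_point n + t) \<partial>count_space UNIV) * indicator ?Q t \<partial>lborel)"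
    by (simp add: nn_integral_multc)
  also have "\<dots> \<le> (\<integral>\<^sup>+t. C * indicator ?Q t \<partial>lborel)"
    using periodic_sum by (intro nn_integral_mono mult_right_mono) auto
  also have "\<dots> = C"
    by (simp add: nn_integral_cmult_indicator vol)
  finally show ?thesis .
qed

text \<open>
  For each \<open>t\<close> the functions \<open>expo (n + t)\<close>, with \<open>n\<close> an integer vector, are orthonormal on the cube,
  because the integral of \<open>expo (m + t) * cnj (expo (n + t)) = expo (m - n)\<close> does not see \<open>t\<close>.
  Bessel's inequality therefore bounds the periodization of \<open>|fourier f|\<^sup>2\<close> at every \<open>t\<close>.
\<close>

lemma fourier_cube_L2_bound:
  fixes f :: "real ^ 'd \<Rightarrow> complex"
  assumes [measurable]: "f \<in> borel_measurable borel"
    and f2: "integrable cube_measure (\<lambda>x. (norm (f x))\<^sup>2)"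
  shows "(\<integral>\<^sup>+t. ennreal ((norm (fourier cube_measure f t))\<^sup>2) \<partial>lborel)
    \<le> ennreal (\<integral>x. (norm (f x))\<^sup>2 \<partial>cube_measure)"
proof (rule nn_integral_periodize)
  interpret prob_space "cube_measure :: (real ^ 'd) measure" by (rule prob_space_cube_measure)
  note sets_cube_measure [measurable_cong]
  have [measurable]: "fourier cube_measure f \<in> borel_measurable borel"
    by (rule fourier_measurable) (auto simp: sets_cube_measure sigma_finite_measure_axioms)
  show "(\<lambda>t. ennreal ((norm (fourier cube_measure f t))\<^sup>2)) \<in> borel_measurable borel"
    by measurable
  fix t :: "real ^ 'd"
  show "(\<integral>\<^sup>+n. ennreal ((norm (fourier cube_measure f (lattice_point n + t)))\<^sup>2) \<partial>count_space UNIV)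
      \<le> ennreal (\<integral>x. (norm (f x))\<^sup>2 \<partial>cube_measure)"
  proof (rule nn_integral_count_space_le)
    fix S :: "(int ^ 'd) set"
    assume S: "finite S"
    have "(\<Sum>n\<in>S. (norm (fourier cube_measure f (lattice_point n + t)))\<^sup>2)
        \<le> (\<integral>x. (norm (f x))\<^sup>2 \<partial>cube_measure)"
      unfolding fourier_alt
    proof (rule bessel_inequality[where K = 1])
      fix m n :: "int ^ 'd"
      have "lattice_point m - lattice_point n = 0 \<longleftrightarrow> m = n"
        by (auto simp: lattice_point_def vec_eq_iff)
      then show "(\<integral>x. expo (lattice_point m + t) x * cnj (expo (lattice_point n + t) x) \<partial>cube_measure)
          = (if m = n then 1 else 0)"
        unfolding expo_diff[symmetric]
        by (simp add: integral_expo_cube lattice_point_def)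
    qed (use S f2 in \<open>auto simp: finite_measure_axioms\<close>)
    then show "(\<Sum>n\<in>S. ennreal ((norm (fourier cube_measure f (lattice_point n + t)))\<^sup>2))
        \<le> ennreal (\<integral>x. (norm (f x))\<^sup>2 \<partial>cube_measure)"
      by (simp add: ennreal_leI)
  qed
qed

section \<open>Interpolation by truncation at a variable height\<close>

text \<open>
  The cut is expressed through \<open>|f|^(p - 1)\<close> because the threshold \<open>s\<close> belonging to a level \<open>l\<close> of the
  transform is then simply proportional to \<open>1 / l\<close>.
\<close>

definition low_part :: "real \<Rightarrow> real \<Rightarrow> ('a \<Rightarrow> complex) \<Rightarrow> 'a \<Rightarrow> complex" where
  "low_part p s f x = (if norm (f x) powr (p - 1) \<le> s then f x else 0)"

text \<open>
  On a finite measure space this boundedness makes the low part square integrable.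
\<close>

lemma norm_low_part_le:
  assumes "1 < p" "0 \<le> s"
  shows "norm (low_part p s f x) \<le> s powr (1 / (p - 1))"
proof (cases "norm (f x) powr (p - 1) \<le> s")
  case True
  have "norm (f x) = (norm (f x) powr (p - 1)) powr (1 / (p - 1))"
    using assms by (simp add: powr_powr)
  also have "\<dots> \<le> s powr (1 / (p - 1))"
    using True assms by (intro powr_mono2) auto
  finally show ?thesis using True by (simp add: low_part_def)
qed (simp add: low_part_def)

lemma norm_high_part_le: "norm (f x - low_part p s f x) * s \<le> norm (f x) powr p"
proof (cases "norm (f x) powr (p - 1) \<le> s")
  case False
  then have "norm (f x) * s \<le> norm (f x) * norm (f x) powr (p - 1)"
    by (intro mult_left_mono) auto
  also have "\<dots> = norm (f x) powr p"
    by (cases "f x = 0") (simp_all add: powr_diff)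
  finally show ?thesis using False by (simp add: low_part_def)
qed (simp add: low_part_def)

lemma low_part_measurable [measurable (raw)]:
  assumes [measurable]: "s \<in> borel_measurable N" "f \<in> borel_measurable borel" "g \<in> borel_measurable N"
  shows "(\<lambda>y. low_part p (s y) f (g y)) \<in> borel_measurable N"
  unfolding low_part_def by measurable

text \<open>
  The threshold \<open>s = 2 \<integral>|f|^p / l\<close> makes the discarded part small in \<open>L\<^sup>1\<close>: where it is nonzero,
  \<open>|f| \<le> |f|^p / s\<close>, so its integral is at most \<open>l / 2\<close>. Its transform is thus everywhere at most
  \<open>l / 2\<close>, and a value of at least \<open>l\<close> must owe its other half to the low part.
\<close>

lemma fourier_low_part_ge:
  fixes f :: "real ^ 'd \<Rightarrow> complex"
  assumes "finite_measure M" and sets_M [measurable_cong]: "sets M = sets borel"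
    and "1 \<le> p" and [measurable]: "f \<in> borel_measurable borel"
    and fp: "integrable M (\<lambda>x. norm (f x) powr p)"
    and l: "0 < l" "l \<le> norm (fourier M f t)"
  shows "l / 2 \<le> norm (fourier M (low_part p (2 * (\<integral>x. norm (f x) powr p \<partial>M) / l) f) t)"
proof -
  interpret finite_measure M by fact
  define I where "I = (\<integral>x. norm (f x) powr p \<partial>M)"
  define s where "s = 2 * I / l"
  let ?g = "low_part p s f"
  have f1: "integrable M f"
  proof (rule Bochner_Integration.integrable_bound)
    show "integrable M (\<lambda>x. 1 + norm (f x) powr p)" using fp by simp
    show "AE x in M. norm (f x) \<le> norm (1 + norm (f x) powr p)"
    proof (rule AE_I2)
      fix x
      have "norm (f x) \<le> 1 + norm (f x) powr p"
      proof (cases "norm (f x) \<le> 1")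
        case True
        then show ?thesis by (simp add: add_increasing2)
      next
        case False
        then have "norm (f x) powr 1 \<le> norm (f x) powr p"
          using \<open>1 \<le> p\<close> by (intro powr_mono) auto
        then show ?thesis using False by simp
      qed
      then show "norm (f x) \<le> norm (1 + norm (f x) powr p)" by simp
    qed
  qed measurable
  \<comment> \<open>If \<open>I\<close> vanished, \<open>f\<close> would be zero almost everywhere and its transform could not reach \<open>l\<close>.\<close>
  have "I \<noteq> 0"
  proof
    assume "I = 0"
    then have "AE x in M. norm (f x) powr p = 0"
      using fp by (simp add: I_def integral_nonneg_eq_0_iff_AE)
    then have "AE x in M. norm (f x) = 0"
      by eventually_elim simp
    then have "(\<integral>x. norm (f x) \<partial>M) = 0"
      by (subst integral_cong_AE[where g = "\<lambda>_. 0"]) auto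
    with norm_fourier_le[of M f t] l show False by simp
  qed
  moreover have "0 \<le> I" by (simp add: I_def)
  ultimately have s: "0 < s" using l by (simp add: s_def)
  have g1: "integrable M ?g"
    by (rule Bochner_Integration.integrable_bound[OF f1]) (auto simp: low_part_def)
  have "norm (fourier M f t - fourier M ?g t) \<le> l / 2"
  proof -
    have [simp]: "integrable M (\<lambda>x. h x * cnj (expo t x))" if "integrable M h" for h
    proof (rule Bochner_Integration.integrable_bound[OF that])
      have [measurable]: "h \<in> borel_measurable borel"
        using borel_measurable_integrable[OF that] measurable_cong_sets[OF sets_M refl] by blast
      have [measurable]: "cnj \<in> borel_measurable borel"
        by (intro borel_measurable_continuous_onI continuous_intros)
      show "(\<lambda>x. h x * cnj (expo t x)) \<in> borel_measurable M" by measurable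
    qed (simp add: norm_mult)
    have "fourier M f t - fourier M ?g t = fourier M (\<lambda>x. f x - ?g x) t"
      unfolding fourier_alt using f1 g1
      by (simp add: left_diff_distrib flip: Bochner_Integration.integral_diff)
    also have "norm \<dots> \<le> (\<integral>x. norm (f x - ?g x) \<partial>M)"
      by (rule norm_fourier_le)
    also have "\<dots> \<le> (\<integral>x. norm (f x) powr p / s \<partial>M)"
      using norm_high_part_le[of f _ p s] s fp f1 g1
      by (intro integral_mono) (auto simp: field_simps)
    also have "\<dots> = I / s" by (simp add: I_def)
    also have "\<dots> = l / 2" using \<open>I \<noteq> 0\<close> l by (simp add: s_def)
    finally show ?thesis .
  qed
  then have "l / 2 \<le> norm (fourier M ?g t)"
    using l norm_triangle_ineq2[of "fourier M f t" "fourier M ?g t"] by linarith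
  then show ?thesis by (simp add: s_def I_def)
qed

lemma nn_integral_powr_0_to:
  fixes a c :: real
  assumes "-1 < a" "0 \<le> c"
  shows "(\<integral>\<^sup>+l. ennreal (l powr a) * indicator {0..c} l \<partial>lborel) = ennreal (c powr (a + 1) / (a + 1))"
  by (rule nn_integral_has_integral_lebesgue'[OF _ has_integral_powr_from_0]) (use assms in auto)

text \<open>
  Where \<open>f x \<noteq> 0\<close>, the low part at level \<open>l\<close> keeps the value \<open>f x\<close> exactly while \<open>l \<le> c = 2 M |f x|^(1 - p)\<close>, so the
  integral is \<open>|f x|\<^sup>2\<close> times that of \<open>l^(q - 3)\<close> over \<open>[0, c]\<close>, where \<open>q = p / (p - 1)\<close>. It converges
  at \<open>0\<close> since \<open>q > 2\<close>, and the powers of \<open>|f x|\<close> combine to \<open>2 + (1 - p) (q - 2) = p\<close>.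
\<close>

lemma nn_integral_low_part:
  fixes p M :: real
  assumes p: "1 < p" "p < 2" and M: "0 \<le> M"
  shows "(\<integral>\<^sup>+l. ennreal (l powr (p / (p - 1) - 3)) * indicator {0<..} l
        * ennreal ((norm (low_part p (2 * M / l) f x))\<^sup>2) \<partial>lborel)
    \<le> ennreal ((2 * M) powr (p / (p - 1) - 2) / (p / (p - 1) - 2) * norm (f x) powr p)"
proof (cases "f x = 0")
  case True
  then have "low_part p s f x = 0" for s
    by (simp add: low_part_def)
  then show ?thesis by simp
next
  case False
  define q where "q = p / (p - 1)"
  define z where "z = norm (f x)"
  define c where "c = 2 * M * z powr (1 - p)"
  have q: "2 < q" and exponent: "2 + (1 - p) * (q - 2) = p"
    using p by (simp_all add: q_def field_simps)
  have z: "0 < z" using False by (simp add: z_def)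
  have c: "0 \<le> c" using M by (simp add: c_def)
  have "(\<integral>\<^sup>+l. ennreal (l powr (q - 3)) * indicator {0<..} l
        * ennreal ((norm (low_part p (2 * M / l) f x))\<^sup>2) \<partial>lborel)
      \<le> (\<integral>\<^sup>+l. ennreal (z\<^sup>2) * (ennreal (l powr (q - 3)) * indicator {0..c} l) \<partial>lborel)"
  proof (rule nn_integral_mono)
    fix l :: real
    have "z powr (p - 1) \<le> 2 * M / l \<longleftrightarrow> l \<le> c" if "0 < l"
      using that z by (simp add: c_def powr_diff field_simps)
    then show "ennreal (l powr (q - 3)) * indicator {0<..} l * ennreal ((norm (low_part p (2 * M / l) f x))\<^sup>2)
        \<le> ennreal (z\<^sup>2) * (ennreal (l powr (q - 3)) * indicator {0..c} l)"
      by (auto simp: low_part_def z_def[symmetric] indicator_def mult.commute)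
  qed
  also have "\<dots> = ennreal (z\<^sup>2) * ennreal (c powr (q - 2) / (q - 2))"
    using nn_integral_powr_0_to[of "q - 3" c] q c by (simp add: nn_integral_cmult)
  also have "\<dots> = ennreal ((2 * M) powr (q - 2) / (q - 2) * (z powr 2 * z powr ((1 - p) * (q - 2))))"
    using M z q by (simp add: c_def powr_mult powr_powr ennreal_mult[symmetric] mult_ac)
  also have "z powr 2 * z powr ((1 - p) * (q - 2)) = z powr p"
    unfolding powr_add[symmetric] exponent ..
  finally show ?thesis by (simp add: q_def z_def)
qed

text \<open>
  Write \<open>|F f|^q = \<integral> q l^(q - 1) dl\<close> over \<open>0 \<le> l \<le> |F f|\<close>, with \<open>F\<close> the transform. On that range
  \<open>l\<^sup>2 \<le> 4 |F (g l)|\<^sup>2\<close> for the low part \<open>g l\<close> of \<open>f\<close>, so \<open>|F f|^q\<close> is at most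
  \<open>4 q \<integral> l^(q - 3) |F (g l)|\<^sup>2 dl\<close>. Integrating in \<open>t\<close> first makes the \<open>L\<^sup>2\<close> bound applicable to
  each \<open>g l\<close>; integrating in \<open>l\<close> next is the computation of the previous lemma and gives back
  \<open>\<integral>|f|^p\<close>. The constant carries the power \<open>(\<integral>|f|^p)^(q - 1)\<close>, which is the \<open>q\<close>-th power of the
  \<open>L\<^sup>p\<close> norm as \<open>q - 1 = q / p\<close>.
\<close>

lemma fourier_Lp_bound_from_L2:
  fixes f :: "real ^ 'd \<Rightarrow> complex" and \<mu> \<nu> :: "(real ^ 'd) measure" and D p q :: real
  assumes "finite_measure \<mu>" and sets_\<mu> [measurable_cong]: "sets \<mu> = sets borel"
    and "sigma_finite_measure \<nu>" and sets_\<nu> [measurable_cong]: "sets \<nu> = sets borel"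
    and p: "1 < p" "p < 2" and q_def: "q = p / (p - 1)"
    and D: "0 \<le> D"
    and L2: "\<And>g. g \<in> borel_measurable borel \<Longrightarrow> integrable \<mu> (\<lambda>x. (norm (g x))\<^sup>2) \<Longrightarrow>
      (\<integral>\<^sup>+t. ennreal ((norm (fourier \<mu> g t))\<^sup>2) \<partial>\<nu>) \<le> ennreal (D * (\<integral>x. (norm (g x))\<^sup>2 \<partial>\<mu>))"
    and f [measurable]: "f \<in> borel_measurable borel"
    and fp: "integrable \<mu> (\<lambda>x. norm (f x) powr p)"
  shows "(\<integral>\<^sup>+t. ennreal (norm (fourier \<mu> f t) powr q) \<partial>\<nu>)
    \<le> ennreal (4 * q * D * 2 powr (q - 2) / (q - 2) * (\<integral>x. norm (f x) powr p \<partial>\<mu>) powr (q - 1))"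
proof -
  interpret \<mu>: finite_measure \<mu> by fact
  interpret \<nu>: sigma_finite_measure \<nu> by fact
  interpret \<nu>l: pair_sigma_finite \<nu> "lborel :: real measure" ..
  interpret \<mu>l: pair_sigma_finite \<mu> "lborel :: real measure" ..
  define M where "M = (\<integral>x. norm (f x) powr p \<partial>\<mu>)"
  have M: "0 \<le> M" by (simp add: M_def)
  have q: "2 < q" using p by (simp add: q_def field_simps)
  define g where "g l = low_part p (2 * M / l) f" for l
  define w where "w l = ennreal (l powr (q - 3)) * indicator {0<..} l" for l :: real
  have [measurable]: "w \<in> borel_measurable borel" unfolding w_def by measurable
  have [measurable]: "(\<lambda>(x, l). g l x) \<in> borel_measurable (borel \<Otimes>\<^sub>M borel)"
    unfolding g_def by measurable
  have [measurable]: "(\<lambda>(t, l). fourier \<mu> (g l) t) \<in> borel_measurable (borel \<Otimes>\<^sub>M borel)"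
    unfolding fourier_def by measurable

  have pointwise: "ennreal (norm (fourier \<mu> f t) powr q)
      \<le> (\<integral>\<^sup>+l. ennreal (4 * q) * (w l * ennreal ((norm (fourier \<mu> (g l) t))\<^sup>2)) \<partial>lborel)" for t
  proof -
    define c where "c = norm (fourier \<mu> f t)"
    have "ennreal (c powr q) = ennreal q * ennreal (c powr q / q)"
      using q by (simp add: ennreal_mult[symmetric])
    also have "\<dots> = (\<integral>\<^sup>+l. ennreal q * (ennreal (l powr (q - 1)) * indicator {0..c} l) \<partial>lborel)"
      using nn_integral_powr_0_to[of "q - 1" c] q by (simp add: nn_integral_cmult c_def)
    also have "\<dots> \<le> (\<integral>\<^sup>+l. ennreal (4 * q) * (w l * ennreal ((norm (fourier \<mu> (g l) t))\<^sup>2)) \<partial>lborel)"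
    proof (rule nn_integral_mono)
      fix l :: real
      show "ennreal q * (ennreal (l powr (q - 1)) * indicator {0..c} l)
          \<le> ennreal (4 * q) * (w l * ennreal ((norm (fourier \<mu> (g l) t))\<^sup>2))"
      proof (cases "0 < l \<and> l \<le> c")
        case True
        then have "l / 2 \<le> norm (fourier \<mu> (g l) t)"
          unfolding g_def M_def c_def
          using fourier_low_part_ge[OF \<mu>.finite_measure_axioms sets_\<mu> _ f fp] p by auto
        then have "(l / 2)\<^sup>2 \<le> (norm (fourier \<mu> (g l) t))\<^sup>2"
          using True by (intro power_mono) auto
        then have "l powr (q - 3) * l\<^sup>2 \<le> l powr (q - 3) * (4 * (norm (fourier \<mu> (g l) t))\<^sup>2)"
          by (intro mult_left_mono) (auto simp: power_divide)
        also have "l powr (q - 3) * l\<^sup>2 = l powr (q - 1)"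
          using True by (simp add: powr_add[symmetric] flip: powr_numeral)
        finally show ?thesis
          using True q by (simp add: w_def ennreal_mult[symmetric] ennreal_leI mult_ac)
      qed (auto simp: indicator_def)
    qed
    finally show ?thesis by (simp add: c_def)
  qed

  have level: "w l * (\<integral>\<^sup>+t. ennreal ((norm (fourier \<mu> (g l) t))\<^sup>2) \<partial>\<nu>)
      \<le> w l * (ennreal D * (\<integral>\<^sup>+x. ennreal ((norm (g l x))\<^sup>2) \<partial>\<mu>))" for l
  proof (cases "0 < l")
    case True
    have sq: "integrable \<mu> (\<lambda>x. (norm (g l x))\<^sup>2)"
    proof (rule \<mu>.integrable_const_bound)
      show "AE x in \<mu>. norm ((norm (g l x))\<^sup>2) \<le> ((2 * M / l) powr (1 / (p - 1)))\<^sup>2"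
        using norm_low_part_le[of p "2 * M / l" f] p M True
        by (auto simp: g_def intro!: power_mono)
    qed measurable
    have "(\<integral>\<^sup>+t. ennreal ((norm (fourier \<mu> (g l) t))\<^sup>2) \<partial>\<nu>) \<le> ennreal (D * (\<integral>x. (norm (g l x))\<^sup>2 \<partial>\<mu>))"
      by (rule L2) (use sq in auto)
    also have "\<dots> = ennreal D * (\<integral>\<^sup>+x. ennreal ((norm (g l x))\<^sup>2) \<partial>\<mu>)"
      using D sq by (simp add: nn_integral_eq_integral ennreal_mult)
    finally show ?thesis by (rule mult_left_mono) simp
  qed (simp add: w_def)

  have "(\<integral>\<^sup>+t. ennreal (norm (fourier \<mu> f t) powr q) \<partial>\<nu>)
      \<le> (\<integral>\<^sup>+t. (\<integral>\<^sup>+l. ennreal (4 * q) * (w l * ennreal ((norm (fourier \<mu> (g l) t))\<^sup>2)) \<partial>lborel) \<partial>\<nu>)"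
    by (intro nn_integral_mono pointwise)
  also have "\<dots> = (\<integral>\<^sup>+l. (\<integral>\<^sup>+t. ennreal (4 * q) * (w l * ennreal ((norm (fourier \<mu> (g l) t))\<^sup>2)) \<partial>\<nu>) \<partial>lborel)"
    by (rule \<nu>l.Fubini'[symmetric]) measurable
  also have "\<dots> = (\<integral>\<^sup>+l. ennreal (4 * q) * (w l * (\<integral>\<^sup>+t. ennreal ((norm (fourier \<mu> (g l) t))\<^sup>2) \<partial>\<nu>)) \<partial>lborel)"
    by (simp add: nn_integral_cmult)
  also have "\<dots> \<le> (\<integral>\<^sup>+l. ennreal (4 * q) * (w l * (ennreal D * (\<integral>\<^sup>+x. ennreal ((norm (g l x))\<^sup>2) \<partial>\<mu>))) \<partial>lborel)"
    by (intro nn_integral_mono mult_left_mono level) simp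
  also have "\<dots> = (\<integral>\<^sup>+l. ennreal (4 * q) * (ennreal D * (\<integral>\<^sup>+x. w l * ennreal ((norm (g l x))\<^sup>2) \<partial>\<mu>)) \<partial>lborel)"
    by (simp add: nn_integral_cmult mult.left_commute)
  also have "\<dots> = ennreal (4 * q) * (ennreal D * (\<integral>\<^sup>+l. (\<integral>\<^sup>+x. w l * ennreal ((norm (g l x))\<^sup>2) \<partial>\<mu>) \<partial>lborel))"
    by (simp add: nn_integral_cmult)
  also have "(\<integral>\<^sup>+l. (\<integral>\<^sup>+x. w l * ennreal ((norm (g l x))\<^sup>2) \<partial>\<mu>) \<partial>lborel)
      = (\<integral>\<^sup>+x. (\<integral>\<^sup>+l. w l * ennreal ((norm (g l x))\<^sup>2) \<partial>lborel) \<partial>\<mu>)"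
    by (rule \<mu>l.Fubini') measurable
  also have "ennreal (4 * q) * (ennreal D * \<dots>)
      \<le> ennreal (4 * q) * (ennreal D * (\<integral>\<^sup>+x. ennreal ((2 * M) powr (q - 2) / (q - 2) * norm (f x) powr p) \<partial>\<mu>))"
    unfolding w_def g_def q_def
    by (intro mult_left_mono nn_integral_mono nn_integral_low_part p M) auto
  also have "\<dots> = ennreal (4 * q) * (ennreal D * ennreal ((2 * M) powr (q - 2) / (q - 2) * M))"
    using fp q by (subst nn_integral_eq_integral) (auto simp: M_def)
  also have "\<dots> = ennreal (4 * q * D * 2 powr (q - 2) / (q - 2) * (M powr (q - 2) * M))"
    using q D M by (simp add: ennreal_mult[symmetric] powr_mult mult_ac)
  also have "M powr (q - 2) * M = M powr (q - 1)"
    using M by (cases "M = 0") (simp_all add: powr_mult_base mult.commute)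
  finally show ?thesis by (simp add: M_def)
qed

text \<open>
  For a probability measure the semi-inner product with \<open>expo t\<close> is the transform at \<open>t\<close>, and the
  norm on the right can be absorbed into a power of the integral.
\<close>

lemma bessel_measure_finite_iff:
  fixes \<mu> \<nu> :: "(real ^ 'd) measure" and p q :: real
  assumes "prob_space \<mu>" "sets \<mu> = sets borel" "sets \<nu> = sets borel" "0 \<le> q"
  shows "bessel_measure p (ennreal q) \<mu> \<nu> \<longleftrightarrow>
    (\<exists>B>0. \<forall>f\<in>borel_measurable borel. integrable \<mu> (\<lambda>x. norm (f x) powr p) \<longrightarrow>
      (\<integral>\<^sup>+t. ennreal (norm (fourier \<mu> f t) powr q) \<partial>\<nu>)
        \<le> ennreal (B * (\<integral>x. norm (f x) powr p \<partial>\<mu>) powr (q / p)))"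
proof -
  have "Lp_space \<mu> p = {f \<in> borel_measurable borel. integrable \<mu> (\<lambda>x. norm (f x) powr p)}"
    unfolding Lp_space_def measurable_cong_sets[OF assms(2) refl] ..
  then show ?thesis
    using assms by (simp add: bessel_measure_def semi_inner_expo Lp_norm_def powr_powr Ball_def imp_conjL)
qed

lemma bessel_measure_2_2_iff:
  fixes \<mu> \<nu> :: "(real ^ 'd) measure"
  assumes "prob_space \<mu>" "sets \<mu> = sets borel" "sets \<nu> = sets borel"
  shows "bessel_measure 2 2 \<mu> \<nu> \<longleftrightarrow>
    (\<exists>B>0. \<forall>f\<in>borel_measurable borel. integrable \<mu> (\<lambda>x. (norm (f x))\<^sup>2) \<longrightarrow>
      (\<integral>\<^sup>+t. ennreal ((norm (fourier \<mu> f t))\<^sup>2) \<partial>\<nu>) \<le> ennreal (B * (\<integral>x. (norm (f x))\<^sup>2 \<partial>\<mu>)))"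
  using bessel_measure_finite_iff[OF assms, of 2 2] by simp

theorem bessel_measure_interpolate:
  fixes \<mu> \<nu> :: "(real ^ 'd) measure" and p :: real
  assumes \<mu>: "prob_space \<mu>" "sets \<mu> = sets borel" and \<nu>: "sigma_finite_measure \<nu>"
    and L2: "bessel_measure 2 2 \<mu> \<nu>" and p: "1 < p" "p < 2"
  shows "bessel_measure p (ennreal (p / (p - 1))) \<mu> \<nu>"
proof -
  interpret prob_space \<mu> by fact
  define q where "q = p / (p - 1)"
  have q: "2 < q" "q / p = q - 1" using p by (simp_all add: q_def field_simps)
  have sets_\<nu>: "sets \<nu> = sets borel" using L2 by (simp add: bessel_measure_def)
  obtain D where D: "0 < D" "\<And>g. g \<in> borel_measurable borel \<Longrightarrow> integrable \<mu> (\<lambda>x. (norm (g x))\<^sup>2) \<Longrightarrow>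
      (\<integral>\<^sup>+t. ennreal ((norm (fourier \<mu> g t))\<^sup>2) \<partial>\<nu>) \<le> ennreal (D * (\<integral>x. (norm (g x))\<^sup>2 \<partial>\<mu>))"
    using L2 unfolding bessel_measure_2_2_iff[OF \<mu> sets_\<nu>] by blast
  have "\<forall>f\<in>borel_measurable borel. integrable \<mu> (\<lambda>x. norm (f x) powr p) \<longrightarrow>
      (\<integral>\<^sup>+t. ennreal (norm (fourier \<mu> f t) powr q) \<partial>\<nu>)
        \<le> ennreal (4 * q * D * 2 powr (q - 2) / (q - 2) * (\<integral>x. norm (f x) powr p \<partial>\<mu>) powr (q - 1))"
    using fourier_Lp_bound_from_L2[OF finite_measure_axioms \<mu>(2) \<nu> sets_\<nu> p q_def less_imp_le[OF D(1)] D(2)]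
    by blast
  moreover have "0 < 4 * q * D * 2 powr (q - 2) / (q - 2)" using q D by simp
  moreover have "0 \<le> q" using q by simp
  ultimately show ?thesis
    unfolding q_def[symmetric] using bessel_measure_finite_iff[OF \<mu> sets_\<nu>, of q p] q(2) by metis
qed

section \<open>The unit cube\<close>

lemma bessel_measure_2_2_cube:
  "bessel_measure 2 2 (cube_measure :: (real ^ 'd) measure) lborel"
  unfolding bessel_measure_2_2_iff[OF prob_space_cube_measure sets_cube_measure sets_lborel]
  using fourier_cube_L2_bound by (intro exI[of _ 1]) auto

lemma conjugate_exponents_1: "conjugate_exponents 1 q \<Longrightarrow> q = \<infinity>"
  by (cases q) (auto simp: conjugate_exponents_def inverse_ennreal ennreal_plus[symmetric] simp del: ennreal_plus
    split: if_splits)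

lemma conjugate_exponents_gt_1:
  assumes "conjugate_exponents p q" "1 < p"
  shows "q = ennreal (p / (p - 1))"
proof (cases q)
  case (real r)
  have "r \<noteq> 0" using assms real by (auto simp: conjugate_exponents_def)
  with real have "0 < r" by simp
  then have "ennreal (inverse p + inverse r) = ennreal 1"
    using assms real by (simp add: conjugate_exponents_def inverse_ennreal)
  then have "inverse p + inverse r = 1"
    using assms \<open>0 < r\<close> by (subst (asm) ennreal_inj) auto
  then have "r = p / (p - 1)"
    using assms \<open>0 < r\<close> by (simp add: field_simps)
  then show ?thesis using real by simp
next
  case top
  then have "ennreal (inverse p) = ennreal 1"
    using assms by (simp add: conjugate_exponents_def inverse_ennreal)
  then have "p = 1" using assms by (subst (asm) ennreal_inj) auto
  with assms show ?thesis by simp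
qed

theorem proposition3p32:
  fixes p :: real and q :: ennreal
  assumes "1 \<le> p" and "p \<le> 2" and "conjugate_exponents p q"
  shows "bessel_measure p q (cube_measure :: (real ^ 'd) measure) lborel"
proof -
  interpret prob_space "cube_measure :: (real ^ 'd) measure"
    by (rule prob_space_cube_measure)
  consider "p = 1" | "p = 2" | "1 < p" "p < 2"
    using assms by linarith
  then show ?thesis
  proof cases
    case 1
    then have "q = \<infinity>"
      using assms conjugate_exponents_1 by simp
    then show ?thesis
      using bessel_measure_1_infinity[OF sigma_finite_measure_axioms sets_cube_measure sets_lborel] 1 by simp
  next
    case 2
    then have "q = 2"
      using assms conjugate_exponents_gt_1 by fastforce
    with 2 show ?thesis by (simp add: bessel_measure_2_2_cube)
  next
    case 3
    then have "q = ennreal (p / (p - 1))"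
      using assms conjugate_exponents_gt_1 by blast
    then show ?thesis
      using bessel_measure_interpolate[OF prob_space_cube_measure sets_cube_measure sigma_finite_lborel
          bessel_measure_2_2_cube 3] by simp
  qed
qed

end
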